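(* Let $N\ge 2$, $1<q<p$, $q<N$, $s\ge 0$, $m>p-1$ and $$s(N-q)+m(N-1)\le N(q-1).$$ Let $u$ be any positive solution of the inequality $$-\Delta_p u-\Delta_q u\ge u^s|\nabla u|^m\quad\text{in }\mathbb R^N .$$ Then $u$ is constant.
   Context: For $r>1$, $\Delta_r u=\operatorname{div}(|\nabla u|^{r-2}\nabla u)$. A positive solution of $-\Delta_p u-\Delta_q u\ge u^s|\nabla u|^m$ in $\mathbb R^N$ is a function $u\in C^1(\mathbb R^N)$, $u>0$, such that $$\int_{\mathbb R^N} |\nabla u|^{p-2}\nabla u\cdot\nabla\varphi\,dx+\int_{\mathbb R^N} |\nabla u|^{q-2}\nabla u\cdot\nabla\varphi\,dx\ge \int_{\mathbb R^N} u^s|\nabla u|^m\varphi\,dx\quad\text{for all }\varphi\in C^1_c(\mathbb R^N),\ \varphi\ge 0.$$ *)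

theory Defs
  imports "HOL-Analysis.Analysis"
begin

definition grad :: "('a::euclidean_space \<Rightarrow> real) \<Rightarrow> 'a \<Rightarrow> 'a" where
  "grad f x = (THE D. GDERIV f x :> D)"

lemma grad_eqI:
  assumes "GDERIV f x :> D"
  shows "grad f x = D"
  unfolding grad_def
proof (rule the_equality)
  show "GDERIV f x :> D" by (rule assms)
next
  fix E assume "GDERIV f x :> E"
  then have "(\<lambda>h. inner h E) = (\<lambda>h. inner h D)"
    using assms unfolding gderiv_def by (rule has_derivative_unique)
  then show "E = D"
    by (metis inner_commute vector_eq_ldot)
qed

lemma GDERIV_grad:
  assumes "f differentiable (at x)"
  shows "GDERIV f x :> grad f x"
proof -
  obtain L where L: "(f has_derivative L) (at x)"
    using assms unfolding differentiable_def by blast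
  interpret bounded_linear L
    using L by (rule has_derivative_bounded_linear)
  have "L = (\<lambda>h. inner h (adjoint L 1))"
    using adjoint_works[OF linear_axioms, of _ 1] by auto
  then have "GDERIV f x :> adjoint L 1"
    using L unfolding gderiv_def by metis
  then show ?thesis
    using grad_eqI by metis
qed

definition C1 :: "('a::euclidean_space \<Rightarrow> real) \<Rightarrow> bool" where
  "C1 f \<longleftrightarrow> (\<forall>x. f differentiable (at x)) \<and> continuous_on UNIV (grad f)"

definition C1_compact_support :: "('a::euclidean_space \<Rightarrow> real) \<Rightarrow> bool" where
  "C1_compact_support f \<longleftrightarrow> C1 f \<and> compact (closure (support_on UNIV f))"

(* The field |grad u|^(r-2) grad u.  Where grad u vanishes it is 0, which is its
   continuous extension for every r > 1. *)
definition flux :: "real \<Rightarrow> ('a::euclidean_space \<Rightarrow> real) \<Rightarrow> 'a \<Rightarrow> 'a" where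
  "flux r u x = (norm (grad u x) powr (r - 2)) *\<^sub>R grad u x"

(* Since u is positive and C1 and the test function is C1 with compact support, all
   integrands are continuous with compact support when 1 < p, 1 < q, 0 < m, so no
   integral takes the default value 0 of a non-integrable function.  With u > 0,
   u powr 0 = 1. *)
definition positive_solution ::
    "real \<Rightarrow> real \<Rightarrow> real \<Rightarrow> real \<Rightarrow> ('a::euclidean_space \<Rightarrow> real) \<Rightarrow> bool" where
  "positive_solution p q s m u \<longleftrightarrow>
     C1 u \<and> (\<forall>x. u x > 0) \<and>
     (\<forall>\<phi>. C1_compact_support \<phi> \<and> (\<forall>x. \<phi> x \<ge> 0) \<longrightarrow>
        (\<integral>x. inner (flux p u x) (grad \<phi> x) \<partial>lborel)
        + (\<integral>x. inner (flux q u x) (grad \<phi> x) \<partial>lborel)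
        \<ge> (\<integral>x. u x powr s * norm (grad u x) powr m * \<phi> x \<partial>lborel))"

end

theory Submission
  imports Defs
begin

text \<open>
  The proof follows the test function method of Mitidieri and Pokhozhaev.  The function \<open>u\<close> is a
  supersolution that is not known to obey any bounds, so all information comes from testing with
  powers of \<open>u\<close> times powers of a cut-off \<open>\<phi>\<close> that equals \<open>1\<close> on the ball of radius
  \<open>R\<close> and vanishes outside the ball of radius \<open>2 R\<close>.

  Testing with \<open>u\<^sup>-\<^sup>\<alpha> \<phi>\<^sup>k\<close> (\<open>energy_inequality\<close>) gives
  \<open>\<alpha> \<integral> u\<^sup>-\<^sup>\<alpha>\<^sup>-\<^sup>1 (\<bar>\<nabla>u\<bar>\<^sup>p + \<bar>\<nabla>u\<bar>\<^sup>q) \<phi>\<^sup>k + \<integral> u\<^sup>s\<^sup>-\<^sup>\<alpha> \<bar>\<nabla>u\<bar>\<^sup>m \<phi>\<^sup>k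
    \<le> k \<integral> u\<^sup>-\<^sup>\<alpha> (\<bar>\<nabla>u\<bar>\<^sup>p\<^sup>-\<^sup>1 + \<bar>\<nabla>u\<bar>\<^sup>q\<^sup>-\<^sup>1) \<phi>\<^sup>k\<^sup>-\<^sup>1 \<bar>\<nabla>\<phi>\<bar>\<close>.
  For \<open>\<alpha> > 0\<close> Young's inequality with three factors absorbs the right-hand side into the left
  up to a power of \<open>R\<close> (\<open>weighted_energy_growth\<close>).  If
  \<open>s (N - q) + m (N - 1) = N (q - 1)\<close>, this power is slightly positive, so this alone does not suffice.  The estimate is
  therefore fed into the inequality for \<open>\<alpha> = 0\<close>: its right-hand side is split into the weighted
  energy just estimated, the volume of the ball, and the reaction term
  \<open>w = u\<^sup>s \<bar>\<nabla>u\<bar>\<^sup>m\<close> on the layer where \<open>\<nabla>\<phi> \<noteq> 0\<close>.  By scale invariance at the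
  critical exponents (\<open>scaling_at_critical_exponents\<close>) no power of \<open>R\<close> is left over, and for
  all \<open>t > 0\<close>, with \<open>C\<close> depending on \<open>t\<close>,
  \<open>\<integral> w \<phi>\<^sup>k \<le> M t + M C \<integral>\<^sub>l\<^sub>a\<^sub>y\<^sub>e\<^sub>r w \<phi>\<^sup>k\<close> (\<open>absorption_estimate\<close>).

  Absorbing the layer integral shows first that \<open>w\<close> is integrable over the whole space; then the
  layer integrals tend to \<open>0\<close> and \<open>t \<rightarrow> 0\<close> gives \<open>\<integral> w = 0\<close>
  (\<open>absorption_imp_integral_nonpos\<close>).  Since \<open>u > 0\<close>, the gradient vanishes identically.
\<close>

section \<open>Young's inequality and the scaling of the exponents\<close>

text \<open>
  The constants of the weighted arithmetic-geometric mean inequality are irrelevant here, so each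
  factor is simply replaced by the sum of all three.
\<close>

lemma weighted_product_le_sum:
  fixes X Y Z :: real
  assumes "0 \<le> X" "0 \<le> Y" "0 \<le> Z" "0 \<le> a" "0 \<le> b" "0 \<le> c" "a + b + c = 1"
  shows "X powr a * Y powr b * Z powr c \<le> X + Y + Z"
proof -
  define S where "S = X + Y + Z"
  have S: "0 \<le> S" "X \<le> S" "Y \<le> S" "Z \<le> S" using assms by (auto simp: S_def)
  have "X powr a * Y powr b * Z powr c \<le> S powr a * S powr b * S powr c"
    using assms S by (intro mult_mono powr_mono2) auto
  also have "\<dots> = S powr (a + b + c)" by (simp add: powr_add)
  also have "\<dots> = S" using assms S by simp
  finally show ?thesis by (simp add: S_def)
qed

text \<open>
  Here \<open>y\<close>, \<open>g\<close>, \<open>f\<close> stand for the values of \<open>u\<close>, \<open>\<bar>\<nabla>u\<bar>\<close>, \<open>\<phi>\<close> at one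
  point.  The two exponent equations say that the powers of \<open>y\<close> and \<open>g\<close> on the left are
  the geometric means of those on the right with weights \<open>\<theta>1\<close> and \<open>\<theta>2\<close>; the remaining
  weight \<open>\<theta>0\<close> falls on the constant term.  Differentiating \<open>\<phi>\<^sup>k\<close> costs one power of
  \<open>\<phi>\<close>, and the condition \<open>k \<theta>0 \<ge> 1\<close> pays for it because \<open>f \<le> 1\<close>.
\<close>

lemma young_pointwise:
  fixes y g f \<theta>0 \<theta>1 \<theta>2 :: real and k :: nat
  assumes y: "0 < y" and g: "0 \<le> g" and f: "0 \<le> f" "f \<le> 1"
    and r: "1 < r" and k: "2 \<le> k" "1 \<le> k * \<theta>0"
    and \<theta>: "0 \<le> \<theta>0" "0 \<le> \<theta>1" "0 \<le> \<theta>2" "\<theta>1 + \<theta>2 + \<theta>0 = 1"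
    and exp_y: "a1 * \<theta>1 + a2 * \<theta>2 = b" and exp_g: "r * \<theta>1 + m * \<theta>2 = r - 1"
    and c: "0 < c1" "0 < c2" "0 < c0" "d \<le> c1 powr \<theta>1 * c2 powr \<theta>2 * c0 powr \<theta>0"
  shows "d * (y powr b * g powr (r - 1) * f ^ (k - 1))
    \<le> c1 * (y powr a1 * g powr r * f ^ k) + c2 * (y powr a2 * g powr m * f ^ k) + c0"
proof (cases "g = 0 \<or> f = 0")
  case True
  then show ?thesis
    using assms by (auto simp: zero_power)
next
  case False
  then have g: "0 < g" and f: "0 < f" using g f by auto
  have fk: "f ^ k = f powr k" "f ^ (k - 1) = f powr (real k - 1)"
    using f k by (simp_all add: powr_realpow[symmetric] of_nat_diff)
  have "k * \<theta>1 + k * \<theta>2 = k * (\<theta>1 + \<theta>2 + \<theta>0) - k * \<theta>0"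
    by (simp add: algebra_simps)
  then have "f powr (real k - 1) \<le> f powr (k * \<theta>1 + k * \<theta>2)"
    using k \<theta> f \<open>f \<le> 1\<close> by (intro powr_mono') auto
  then have "d * (y powr b * g powr (r - 1) * f powr (real k - 1))
      \<le> (c1 powr \<theta>1 * c2 powr \<theta>2 * c0 powr \<theta>0) * (y powr b * g powr (r - 1) * f powr (k * \<theta>1 + k * \<theta>2))"
    by (intro mult_mono[OF c(4)] mult_left_mono) auto
  also have "\<dots> = (c1 * (y powr a1 * g powr r * f powr k)) powr \<theta>1
       * (c2 * (y powr a2 * g powr m * f powr k)) powr \<theta>2 * c0 powr \<theta>0"
    using y g f c by (simp add: powr_mult powr_powr powr_add exp_y[symmetric] exp_g[symmetric])
  also have "\<dots> \<le> c1 * (y powr a1 * g powr r * f powr k) + c2 * (y powr a2 * g powr m * f powr k) + c0"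
    using c \<theta> by (intro weighted_product_le_sum) auto
  finally show ?thesis unfolding fk .
qed

text \<open>
  The exponents \<open>\<theta>1\<close>, \<open>\<theta>2\<close> are determined by matching the powers of \<open>y\<close> and
  \<open>g\<close> in \<open>y\<^sup>-\<^sup>\<alpha> g\<^sup>r\<^sup>-\<^sup>1\<close> against those of the weighted energy and the weighted reaction
  term, and \<open>e = 1 / \<theta>0\<close> is the resulting power of \<open>R\<close>.  Both terms that carry
  \<open>\<epsilon>\<close> can then be absorbed by the left-hand side of the energy inequality.
\<close>

lemma young_with_weight:
  fixes r s m \<alpha> :: real
  assumes "1 < r" "0 \<le> s" "0 < \<alpha>" "\<alpha> < r - 1" "r - 1 < m" "r * \<alpha> < m"
  defines "e \<equiv> (r * s + m + (m - r) * \<alpha>) / (s + m - r + 1)"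
  shows "\<forall>\<^sub>F k in sequentially. \<forall>\<epsilon>>0. \<exists>C>0. \<forall>R>0. \<forall>y>0. \<forall>g\<ge>0. \<forall>f\<in>{0..1}.
     1 / R * (y powr (-\<alpha>) * g powr (r - 1) * f ^ (k - 1))
     \<le> \<epsilon> * (y powr (-\<alpha> - 1) * g powr r * f ^ k) + \<epsilon> * (y powr (s - \<alpha>) * g powr m * f ^ k)
       + C * R powr (- e)"
proof -
  define D where "D = r * s + m + (m - r) * \<alpha>"
  have "0 \<le> r * s" "0 < m * \<alpha>" using assms by auto
  moreover have "D = r * s + m * \<alpha> + (m - r * \<alpha>)" by (simp add: D_def algebra_simps)
  ultimately have D: "D > 0" using assms by linarith
  define \<theta>0 where "\<theta>0 = (s + m - r + 1) / D"
  define \<theta>1 where "\<theta>1 = ((r - 1) * s + (m - r + 1) * \<alpha>) / D"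
  define \<theta>2 where "\<theta>2 = (r - 1 - \<alpha>) / D"
  have \<theta>: "0 < \<theta>0" "0 \<le> \<theta>1" "0 < \<theta>2"
    using assms D by (simp_all add: \<theta>0_def \<theta>1_def \<theta>2_def)
  have sum: "\<theta>1 + \<theta>2 + \<theta>0 = 1"
    using D by (simp add: \<theta>0_def \<theta>1_def \<theta>2_def field_simps) (simp add: D_def algebra_simps)
  have exp_y: "(-\<alpha> - 1) * \<theta>1 + (s - \<alpha>) * \<theta>2 = -\<alpha>"
    using D by (simp add: \<theta>0_def \<theta>1_def \<theta>2_def field_simps) (simp add: D_def algebra_simps)
  have exp_g: "r * \<theta>1 + m * \<theta>2 = r - 1"
    using D by (simp add: \<theta>0_def \<theta>1_def \<theta>2_def field_simps) (simp add: D_def algebra_simps)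
  have e: "e * \<theta>0 = 1"
    using assms D by (simp add: e_def \<theta>0_def D_def)
  have "\<forall>\<^sub>F k in sequentially. 2 \<le> k \<and> 1 / \<theta>0 \<le> real k"
    by (intro eventually_conj eventually_ge_at_top)
       (rule filterlim_at_top[THEN iffD1, rule_format, OF filterlim_real_sequentially])
  then show ?thesis
  proof (rule eventually_mono, intro allI impI)
    fix k :: nat and \<epsilon> :: real
    assume k: "2 \<le> k \<and> 1 / \<theta>0 \<le> real k" and \<epsilon>: "\<epsilon> > 0"
    have k1: "1 \<le> real k * \<theta>0" using k \<theta> by (simp add: field_simps)
    define C where "C = \<epsilon> powr (- ((\<theta>1 + \<theta>2) / \<theta>0))"
    show "\<exists>C>0. \<forall>R>0. \<forall>y>0. \<forall>g\<ge>0. \<forall>f\<in>{0..1}.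
     1 / R * (y powr (-\<alpha>) * g powr (r - 1) * f ^ (k - 1))
     \<le> \<epsilon> * (y powr (-\<alpha> - 1) * g powr r * f ^ k) + \<epsilon> * (y powr (s - \<alpha>) * g powr m * f ^ k)
       + C * R powr (- e)"
    proof (intro exI[of _ C] conjI allI impI ballI)
      show "C > 0" using \<epsilon> by (simp add: C_def)
      fix R y g f :: real
      assume a: "R > 0" "y > 0" "g \<ge> 0" "f \<in> {0..1}"
      have "\<epsilon> powr \<theta>1 * \<epsilon> powr \<theta>2 * (C * R powr (- e)) powr \<theta>0
          = (\<epsilon> powr (\<theta>1 + \<theta>2) * \<epsilon> powr (- ((\<theta>1 + \<theta>2) / \<theta>0) * \<theta>0)) * R powr (- (e * \<theta>0))"
        by (simp add: C_def powr_mult powr_powr powr_add)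
      also have "\<dots> = 1 / R"
        using \<theta> \<epsilon> a by (simp add: e powr_add[symmetric] powr_minus inverse_eq_divide)
      finally have "1 / R \<le> \<epsilon> powr \<theta>1 * \<epsilon> powr \<theta>2 * (C * R powr (- e)) powr \<theta>0" by simp
      then show "1 / R * (y powr (-\<alpha>) * g powr (r - 1) * f ^ (k - 1))
     \<le> \<epsilon> * (y powr (-\<alpha> - 1) * g powr r * f ^ k) + \<epsilon> * (y powr (s - \<alpha>) * g powr m * f ^ k)
       + C * R powr (- e)"
        using a k k1 \<theta> \<epsilon> \<open>C > 0\<close> assms(1) sum exp_y exp_g
        by (intro young_pointwise[where ?\<theta>0.0 = \<theta>0 and ?\<theta>1.0 = \<theta>1 and ?\<theta>2.0 = \<theta>2]) auto
    qed
  qed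
qed

text \<open>
  This is the analogue for \<open>\<alpha> = 0\<close> in the energy inequality.  The energy weighted with
  \<open>y\<^sup>-\<^sup>\<alpha>\<^sup>-\<^sup>1\<close> has been estimated before, with integral of order \<open>R\<^sup>\<kappa>\<close>, and a ball has
  volume of order \<open>R\<^sup>N\<close>; the factors \<open>R\<^sup>-\<^sup>\<kappa>\<close> and \<open>R\<^sup>-\<^sup>N\<close> normalise both.  The
  scaling hypothesis is \<open>\<kappa> \<theta>1 + N \<theta>0 \<le> 1\<close>: the powers of \<open>R\<close> that this costs do not
  exceed the factor \<open>1 / R\<close> gained from \<open>\<nabla>\<phi>\<close>.  The parameter \<open>t\<close> trades the
  two normalised terms against the reaction term, whose coefficient may be any
  \<open>C \<ge> t\<^sup>-\<^sup>\<gamma>\<close>.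
\<close>

lemma young_without_weight:
  fixes r s m \<alpha> \<kappa> N :: real
  assumes "1 < r" "0 \<le> s" "0 < \<alpha>" "r - 1 < m"
    and scaling: "\<kappa> * ((r - 1) * s) + N * (r * s + m * (1 + \<alpha>) - (r - 1) * (1 + \<alpha> + s))
                \<le> r * s + m * (1 + \<alpha>)"
  shows "\<forall>\<^sub>F k in sequentially. \<exists>\<gamma>>0. \<forall>t>0. \<forall>C\<ge>t powr (-\<gamma>). \<forall>R\<ge>1. \<forall>y>0. \<forall>g\<ge>0. \<forall>f\<in>{0..1}.
     1 / R * (g powr (r - 1) * f ^ (k - 1))
     \<le> t * R powr (-\<kappa>) * (y powr (-\<alpha> - 1) * g powr r * f ^ k)
       + C * (y powr s * g powr m * f ^ k) + t * R powr (- N)"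
proof -
  define D where "D = r * s + m * (1 + \<alpha>)"
  have "0 \<le> r * s" "0 < m * (1 + \<alpha>)" using assms by auto
  then have D: "D > 0" unfolding D_def by linarith
  define \<theta>0 where "\<theta>0 = ((m - r + 1) * (1 + \<alpha>) + s) / D"
  define \<theta>1 where "\<theta>1 = (r - 1) * s / D"
  define \<theta>2 where "\<theta>2 = (r - 1) * (1 + \<alpha>) / D"
  have "0 < (m - r + 1) * (1 + \<alpha>)" using assms by simp
  then have "0 < (m - r + 1) * (1 + \<alpha>) + s" using assms by linarith
  then have \<theta>: "0 < \<theta>0" "0 \<le> \<theta>1" "0 < \<theta>2"
    using assms D by (simp_all add: \<theta>0_def \<theta>1_def \<theta>2_def)
  have sum: "\<theta>1 + \<theta>2 + \<theta>0 = 1"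
    using D by (simp add: \<theta>0_def \<theta>1_def \<theta>2_def field_simps) (simp add: D_def algebra_simps)
  have exp_y: "(-\<alpha> - 1) * \<theta>1 + s * \<theta>2 = 0"
    using D by (simp add: \<theta>0_def \<theta>1_def \<theta>2_def field_simps)
  have exp_g: "r * \<theta>1 + m * \<theta>2 = r - 1"
    using D by (simp add: \<theta>0_def \<theta>1_def \<theta>2_def field_simps) (simp add: D_def algebra_simps)
  have scal: "\<kappa> * \<theta>1 + N * \<theta>0 \<le> 1"
  proof -
    have "\<kappa> * \<theta>1 + N * \<theta>0
        = (\<kappa> * ((r - 1) * s) + N * (r * s + m * (1 + \<alpha>) - (r - 1) * (1 + \<alpha> + s))) / D"
      by (simp add: \<theta>0_def \<theta>1_def add_divide_distrib[symmetric]) (simp add: algebra_simps)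
    also have "\<dots> \<le> 1" using D scaling by (simp add: D_def)
    finally show ?thesis .
  qed
  define \<gamma> where "\<gamma> = (\<theta>1 + \<theta>0) / \<theta>2"
  have \<gamma>: "\<gamma> > 0" using \<theta> by (simp add: \<gamma>_def)
  have "\<forall>\<^sub>F k in sequentially. 2 \<le> k \<and> 1 / \<theta>0 \<le> real k"
    by (intro eventually_conj eventually_ge_at_top)
       (rule filterlim_at_top[THEN iffD1, rule_format, OF filterlim_real_sequentially])
  then show ?thesis
  proof (rule eventually_mono, intro exI[of _ \<gamma>] conjI allI impI ballI \<gamma>)
    fix k :: nat and t C R y g f :: real
    assume k: "2 \<le> k \<and> 1 / \<theta>0 \<le> real k" and t: "t > 0" and C: "t powr (-\<gamma>) \<le> C"
      and a: "R \<ge> 1" "y > 0" "g \<ge> 0" "f \<in> {0..1}"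
    have k1: "1 \<le> real k * \<theta>0" using k \<theta> by (simp add: field_simps)
    have "C > 0" using C t by (smt (verit) powr_gt_zero)
    have "1 / R = R powr (- 1)" using a by (simp add: powr_minus inverse_eq_divide)
    also have "\<dots> \<le> R powr (- (\<kappa> * \<theta>1 + N * \<theta>0))"
      using a scal by (intro powr_mono) auto
    also have "\<dots> = (t powr (\<theta>1 + \<theta>0) * t powr (- \<gamma> * \<theta>2)) * R powr (- (\<kappa> * \<theta>1 + N * \<theta>0))"
      using \<theta> t by (simp add: \<gamma>_def powr_add[symmetric])
    also have "\<dots> = (t * R powr (-\<kappa>)) powr \<theta>1 * (t powr (-\<gamma>)) powr \<theta>2 * (t * R powr (- N)) powr \<theta>0"
    proof -
      have "R powr (- (\<kappa> * \<theta>1 + N * \<theta>0)) = R powr (- \<kappa> * \<theta>1) * R powr (- N * \<theta>0)"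
        by (simp add: powr_add[symmetric])
      then show ?thesis using t a by (simp add: powr_mult powr_powr powr_add)
    qed
    also have "\<dots> \<le> (t * R powr (-\<kappa>)) powr \<theta>1 * C powr \<theta>2 * (t * R powr (- N)) powr \<theta>0"
      using C \<theta> by (intro mult_right_mono mult_left_mono powr_mono2) auto
    finally have "1 / R \<le> \<dots>" .
    then have "1 / R * (y powr 0 * g powr (r - 1) * f ^ (k - 1))
     \<le> t * R powr (-\<kappa>) * (y powr (-\<alpha> - 1) * g powr r * f ^ k)
       + C * (y powr s * g powr m * f ^ k) + t * R powr (- N)"
        using a k k1 \<theta> t \<open>C > 0\<close> assms(1) sum exp_y exp_g
        by (intro young_pointwise[where ?\<theta>0.0 = \<theta>0 and ?\<theta>1.0 = \<theta>1 and ?\<theta>2.0 = \<theta>2]) auto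
    then show "1 / R * (g powr (r - 1) * f ^ (k - 1))
     \<le> t * R powr (-\<kappa>) * (y powr (-\<alpha> - 1) * g powr r * f ^ k)
       + C * (y powr s * g powr m * f ^ k) + t * R powr (- N)"
      using a by simp
  qed
qed

text \<open>
  The inequality relating \<open>s\<close> and \<open>m\<close> to \<open>N\<close> and \<open>q\<close> enters the proof only here.
  For \<open>r = q\<close> the claim becomes an identity when that inequality is an equality: at the critical exponents the estimate for the
  \<open>q\<close>-Laplacian is scale invariant for every \<open>\<alpha>\<close>, so the loss in \<open>\<kappa>\<close> caused by
  \<open>\<alpha> > 0\<close> is recovered exactly.  For \<open>s = 0\<close> the energy drops out, and passing from
  \<open>q\<close> to \<open>p\<close> only helps.  For \<open>s > 0\<close> and \<open>r = p\<close> the claim follows because the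
  difference \<open>F r\<close> of the two sides is affine in \<open>r\<close>, with \<open>F 1 \<ge> 0 \<ge> F q\<close> and \<open>1 < q < p\<close>.
\<close>

lemma scaling_at_critical_exponents:
  fixes N p q s m \<alpha> :: real
  assumes "1 \<le> N" "1 < q" "q < p" "p - 1 < m" "0 \<le> s" "0 < \<alpha>" "s = 0 \<or> \<alpha> < s"
    and crit: "s * (N - q) + m * (N - 1) \<le> N * (q - 1)"
  defines "e \<equiv> \<lambda>r. (r * s + m + (m - r) * \<alpha>) / (s + m - r + 1)"
  defines "\<kappa> \<equiv> N - min (e p) (e q)"
  assumes r: "r \<in> {p, q}"
  shows "\<kappa> * ((r - 1) * s) + N * (r * s + m * (1 + \<alpha>) - (r - 1) * (1 + \<alpha> + s))
           \<le> r * s + m * (1 + \<alpha>)"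
proof (cases "s = 0")
  case True
  have "N * (m - (q - 1)) \<le> m" using crit True by (simp add: algebra_simps)
  moreover have "N * (m - (r - 1)) \<le> N * (m - (q - 1))"
    using r assms by (intro mult_left_mono) auto
  ultimately have "(1 + \<alpha>) * (N * (m - (r - 1))) \<le> (1 + \<alpha>) * m"
    using \<open>0 < \<alpha>\<close> by (intro mult_left_mono) auto
  then show ?thesis using True by (simp add: algebra_simps)
next
  case False
  then have s: "0 < s" "\<alpha> < s" using assms by auto
  define S where "S = s + m - q + 1"
  have S: "0 < S" "0 < s + m - p + 1" using assms by (auto simp: S_def)
  have e_eq: "e r = (r * (s - \<alpha>) + m * (1 + \<alpha>)) / (s + m - r + 1)" for r
    by (simp add: e_def algebra_simps)
  have "e q \<le> e p"
    unfolding e_eq using assms s S by (intro frac_le add_mono mult_right_mono) (auto simp: S_def)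
  then have \<kappa>: "\<kappa> = N - e q" by (simp add: \<kappa>_def)
  define F where "F = (\<lambda>r. \<kappa> * ((r - 1) * s) + N * (r * s + m * (1 + \<alpha>) - (r - 1) * (1 + \<alpha> + s))
           - (r * s + m * (1 + \<alpha>)))"
  have F1: "F 1 = (N - 1) * (s + m * (1 + \<alpha>))"
    by (simp add: F_def algebra_simps)
  then have "0 \<le> F 1" using assms by simp
  have NS: "N * S \<le> q * s + m"
    using crit by (simp add: S_def algebra_simps)
  have eqS: "e q * S = q * s + m + (m - q) * \<alpha>"
    using S by (simp add: e_def S_def)
  have "F q * S = (N * S) * (q * s + (m - q + 1) * (1 + \<alpha>)) - (e q * S) * ((q - 1) * s) - (q * s + m * (1 + \<alpha>)) * S"
    by (simp add: F_def \<kappa> algebra_simps)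
  also have "\<dots> \<le> (q * s + m) * (q * s + (m - q + 1) * (1 + \<alpha>)) - (e q * S) * ((q - 1) * s) - (q * s + m * (1 + \<alpha>)) * S"
    using NS assms by (intro diff_right_mono mult_right_mono) auto
  also have "\<dots> = 0"
    unfolding eqS by (simp add: S_def algebra_simps)
  finally have Fq: "F q \<le> 0" using S by (simp add: mult_le_0_iff)
  \<comment> \<open>Affine extrapolation from \<open>1\<close> and \<open>q\<close> to \<open>p\<close>, cleared of denominators.\<close>
  have "F p * (q - 1) = F q * (p - 1) - F 1 * (p - q)"
    by (simp add: F_def algebra_simps)
  also have "\<dots> \<le> 0"
  proof -
    have "F q * (p - 1) \<le> 0" using Fq assms by (simp add: mult_le_0_iff)
    moreover have "0 \<le> F 1 * (p - q)" using \<open>0 \<le> F 1\<close> assms by simp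
    ultimately show ?thesis by linarith
  qed
  finally have "F p \<le> 0" using assms by (simp add: mult_le_0_iff)
  then have "F r \<le> 0" using r Fq by auto
  then show ?thesis by (simp add: F_def)
qed

section \<open>Cut-off functions\<close>

text \<open>
  The square of the positive part is \<open>C\<^sup>1\<close>, so composing it with polynomials in
  \<open>\<bar>x\<bar>\<^sup>2\<close> gives explicit \<open>C\<^sup>1\<close> cut-off functions whose gradient can be
  read off.
\<close>

definition pos_sq :: "real \<Rightarrow> real" where
  "pos_sq t = (max 0 t)\<^sup>2"

lemma DERIV_pos_sq: "DERIV pos_sq t :> 2 * max 0 t"
proof -
  consider "t > 0" | "t < 0" | "t = 0" by linarith
  then show ?thesis
  proof cases
    case 1
    have "DERIV (\<lambda>t. t\<^sup>2) t :> 2 * max 0 t"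
      using 1 by (auto intro!: derivative_eq_intros)
    then show ?thesis
      by (rule has_field_derivative_transform_within_open[of _ _ _ "{0<..}"])
        (use 1 in \<open>auto simp: pos_sq_def\<close>)
  next
    case 2
    have "DERIV (\<lambda>t. 0) t :> 2 * max 0 t"
      using 2 by auto
    then show ?thesis
      by (rule has_field_derivative_transform_within_open[of _ _ _ "{..<0}"])
        (use 2 in \<open>auto simp: pos_sq_def\<close>)
  next
    case 3
    have "((\<lambda>h::real. max 0 h * (max 0 h / h)) \<longlongrightarrow> 0) (at 0)"
    proof (rule Lim_null_comparison)
      show "eventually (\<lambda>h::real. norm (max 0 h * (max 0 h / h)) \<le> \<bar>h\<bar>) (at 0)"
        by (rule always_eventually) (auto simp: max_def)
      show "((\<lambda>h::real. \<bar>h\<bar>) \<longlongrightarrow> 0) (at 0)"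
        by (rule tendsto_eq_intros | simp)+
    qed
    then show ?thesis
      using 3 by (simp add: DERIV_def pos_sq_def power2_eq_square)
  qed
qed

definition cutoff :: "real \<Rightarrow> 'a::euclidean_space \<Rightarrow> real" where
  "cutoff R x = pos_sq (1 - pos_sq ((norm x)\<^sup>2 / R\<^sup>2 - 1))"

lemma cutoff_nonneg: "0 \<le> cutoff R x"
  and cutoff_le_1: "cutoff R x \<le> 1"
proof -
  show "0 \<le> cutoff R x" by (simp add: cutoff_def pos_sq_def)
  have "max 0 (1 - pos_sq ((norm x)\<^sup>2 / R\<^sup>2 - 1)) \<le> 1"
    by (simp add: pos_sq_def)
  then show "cutoff R x \<le> 1"
    unfolding cutoff_def pos_sq_def[of "1 - _"] by (intro power_le_one) auto
qed

lemma cutoff_eq_1: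
  assumes "R > 0" "norm x \<le> R" shows "cutoff R x = 1"
proof -
  have "(norm x)\<^sup>2 / R\<^sup>2 \<le> 1"
    using assms by (simp add: power_mono)
  then show ?thesis by (simp add: cutoff_def pos_sq_def)
qed

lemma cutoff_eq_0:
  assumes "R > 0" "2 * R\<^sup>2 \<le> (norm x)\<^sup>2" shows "cutoff R x = 0"
proof -
  have "(norm x)\<^sup>2 / R\<^sup>2 - 1 \<ge> 1"
    using assms by (simp add: field_simps)
  then have "pos_sq ((norm x)\<^sup>2 / R\<^sup>2 - 1) \<ge> 1"
    by (simp add: pos_sq_def)
  then show ?thesis by (simp add: cutoff_def pos_sq_def)
qed

lemma cutoff_eq_0_outside:
  assumes "R > 0" "x \<notin> cball 0 (2 * R)" shows "cutoff R x = 0"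
proof -
  have "(2 * R)\<^sup>2 \<le> (norm x)\<^sup>2"
    using assms by (intro power_mono) auto
  moreover have "(2 * R)\<^sup>2 = 4 * R\<^sup>2" by (simp add: power2_eq_square)
  ultimately have "2 * R\<^sup>2 \<le> (norm x)\<^sup>2"
    using zero_le_power2[of R] by linarith
  then show ?thesis by (rule cutoff_eq_0[OF assms(1)])
qed

lemma GDERIV_cutoff:
  fixes x :: "'a::euclidean_space"
  shows "GDERIV (cutoff R) x :>
    (- 8 * max 0 (1 - pos_sq ((norm x)\<^sup>2 / R\<^sup>2 - 1)) * max 0 ((norm x)\<^sup>2 / R\<^sup>2 - 1) / R\<^sup>2) *\<^sub>R x"
proof -
  have 1: "GDERIV (\<lambda>x. (norm x)\<^sup>2 / R\<^sup>2 - 1) x :> (2 / R\<^sup>2) *\<^sub>R x"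
  proof -
    have "GDERIV (\<lambda>x. inner x x) x :> 2 *\<^sub>R x"
      unfolding gderiv_def by (auto intro!: derivative_eq_intros simp: inner_commute)
    moreover have "DERIV (\<lambda>t. t / R\<^sup>2 - 1) (inner x x) :> 1 / R\<^sup>2"
      unfolding divide_inverse by (auto intro!: derivative_eq_intros)
    ultimately show ?thesis
      unfolding power2_norm_eq_inner by (rule GDERIV_subst[OF GDERIV_DERIV_compose]) simp
  qed
  have 2: "DERIV (\<lambda>t. pos_sq (1 - pos_sq t)) t :> 2 * max 0 (1 - pos_sq t) * (- (2 * max 0 t))" for t
    by (rule derivative_eq_intros DERIV_chain2[OF DERIV_pos_sq] refl | simp)+
  show ?thesis
    unfolding cutoff_def[abs_def]
    by (rule GDERIV_subst[OF GDERIV_DERIV_compose[OF 1 2]]) simp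
qed

lemma grad_cutoff:
  fixes x :: "'a::euclidean_space"
  shows "grad (cutoff R) x =
    (- 8 * max 0 (1 - pos_sq ((norm x)\<^sup>2 / R\<^sup>2 - 1)) * max 0 ((norm x)\<^sup>2 / R\<^sup>2 - 1) / R\<^sup>2) *\<^sub>R x"
  by (rule grad_eqI[OF GDERIV_cutoff])

lemma C1_cutoff: "C1 (cutoff R :: 'a::euclidean_space \<Rightarrow> real)"
  unfolding C1_def
proof (intro conjI allI)
  fix x :: 'a
  show "cutoff R differentiable (at x)"
    using GDERIV_cutoff[of R x] unfolding gderiv_def differentiable_def by blast
next
  have "continuous_on UNIV pos_sq"
    unfolding pos_sq_def[abs_def] by (intro continuous_intros)
  then have "continuous_on UNIV (\<lambda>x::'a. pos_sq ((norm x)\<^sup>2 * inverse (R\<^sup>2) - 1))"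
    by (rule continuous_on_compose2) (auto intro!: continuous_on_diff continuous_on_mult continuous_on_power continuous_on_norm continuous_on_id continuous_on_const)
  then show "continuous_on UNIV (grad (cutoff R :: 'a \<Rightarrow> real))"
    unfolding grad_cutoff[abs_def] divide_inverse
    by (intro continuous_on_scaleR continuous_on_diff continuous_on_mult continuous_on_max
        continuous_on_power continuous_on_norm continuous_on_id continuous_on_const)
qed

lemma grad_cutoff_eq_0:
  assumes "R > 0" "norm x \<le> R" shows "grad (cutoff R) x = 0"
proof -
  have "(norm x)\<^sup>2 / R\<^sup>2 \<le> 1"
    using assms by (simp add: power_mono)
  then show ?thesis by (simp add: grad_cutoff)
qed

lemma norm_grad_cutoff_le:
  fixes x :: "'a::euclidean_space"
  assumes "R > 0" shows "norm (grad (cutoff R) x) \<le> 16 / R"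
proof (cases "2 * R\<^sup>2 \<le> (norm x)\<^sup>2")
  case True
  then have "(norm x)\<^sup>2 / R\<^sup>2 - 1 \<ge> 1"
    using assms by (simp add: field_simps)
  then have "pos_sq ((norm x)\<^sup>2 / R\<^sup>2 - 1) \<ge> 1"
    by (simp add: pos_sq_def)
  then show ?thesis using assms by (simp add: grad_cutoff)
next
  case False
  define a where "a = max 0 (1 - pos_sq ((norm x)\<^sup>2 / R\<^sup>2 - 1))"
  define b where "b = max 0 ((norm x)\<^sup>2 / R\<^sup>2 - 1)"
  have a: "0 \<le> a" "a \<le> 1" by (auto simp: a_def pos_sq_def)
  have b: "0 \<le> b" "b \<le> 1" using False assms by (auto simp: b_def field_simps)
  have "(2 * R)\<^sup>2 = 4 * R\<^sup>2" by (simp add: power2_eq_square)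
  then have "(norm x)\<^sup>2 \<le> (2 * R)\<^sup>2"
    using False zero_le_power2[of R] by linarith
  then have x: "norm x \<le> 2 * R"
    by (rule power2_le_imp_le) (use assms in simp)
  have "norm (grad (cutoff R) x) = 8 * (a * b) * norm x / R\<^sup>2"
    using a b by (simp add: grad_cutoff a_def[symmetric] b_def[symmetric] abs_mult)
  also have "\<dots> \<le> 8 * (1 * 1) * (2 * R) / R\<^sup>2"
    using a b x assms by (intro divide_right_mono mult_mono) auto
  also have "\<dots> = 16 / R" by (simp add: power2_eq_square)
  finally show ?thesis .
qed

section \<open>Integrals of continuous functions\<close>

lemma integrable_continuous_compact_support:
  fixes f :: "'a::euclidean_space \<Rightarrow> real"
  assumes "continuous_on UNIV f" "\<And>x. x \<notin> cball 0 \<rho> \<Longrightarrow> f x = 0"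
  shows "integrable lborel f"
proof -
  have "integrable lborel (\<lambda>x. indicator (cball 0 \<rho>) x *\<^sub>R f x)"
    by (intro borel_integrable_compact continuous_on_subset[OF assms(1)]) auto
  moreover have "(\<lambda>x. indicator (cball 0 \<rho>) x *\<^sub>R f x) = f"
    using assms(2) by (auto simp: fun_eq_iff indicator_def)
  ultimately show ?thesis by simp
qed

text \<open>
  A nonnegative function with vanishing integral is zero almost everywhere; its zero set is closed,
  and a closed set of full measure in an open ball contains the ball.
\<close>

lemma continuous_nonneg_eq_0:
  fixes f :: "'a::euclidean_space \<Rightarrow> real"
  assumes cont: "continuous_on UNIV f" and nonneg: "\<And>x. f x \<ge> 0"
    and int: "\<And>j::nat. (\<integral>x. indicator (cball 0 (2 ^ j)) x * f x \<partial>lborel) \<le> 0"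
  shows "f x = 0"
proof -
  obtain j :: nat where "norm x < 2 ^ j"
    using real_arch_pow[of 2] by auto
  have integrable: "integrable lborel (\<lambda>x. indicator (cball 0 (2 ^ j)) x * f x)"
    using borel_integrable_compact[of "cball 0 (2 ^ j)" f] continuous_on_subset[OF cont] by auto
  have "(\<integral>x. indicator (cball 0 (2 ^ j)) x * f x \<partial>lborel) = 0"
    by (intro antisym int integral_nonneg_AE AE_I2) (simp add: nonneg)
  then have "AE x in lborel. indicator (cball 0 (2 ^ j)) x * f x = 0"
    using integral_nonneg_eq_0_iff_AE[OF integrable] nonneg by simp
  then have "AE x in lebesgue. x \<in> {x. f x = 0} \<union> - ball 0 (2 ^ j)"
    by (intro AE_completion) (auto elim!: eventually_mono simp: indicator_def split: if_splits)
  moreover have "closed ({x. f x = 0} \<union> - ball 0 (2 ^ j))"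
    by (intro closed_Un closed_Collect_eq cont continuous_on_const) auto
  ultimately have "x \<in> {x. f x = 0} \<union> - ball 0 (2 ^ j)"
    by (intro mem_closed_if_AE_lebesgue) auto
  then show ?thesis using \<open>norm x < 2 ^ j\<close> by simp
qed

lemma C1_continuous:
  assumes "C1 f" shows "continuous_on UNIV f"
  using assms unfolding C1_def continuous_on_eq_continuous_within
  by (auto intro: differentiable_imp_continuous_within)

lemma continuous_on_positive_powr:
  assumes "C1 u" "\<And>x. 0 < u x" shows "continuous_on UNIV (\<lambda>x. u x powr a)"
  using assms(2) by (intro continuous_on_powr C1_continuous[OF assms(1)] continuous_on_const)
    (auto simp: less_imp_neq[symmetric])

lemma continuous_on_norm_grad_powr:
  assumes "C1 u" "0 < b" shows "continuous_on UNIV (\<lambda>x. norm (grad u x) powr b)"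
proof -
  have "continuous_on UNIV (grad u)" using assms by (simp add: C1_def)
  then show ?thesis
    using assms(2) by (intro continuous_on_powr' continuous_on_norm continuous_on_const) auto
qed

section \<open>The energy inequality\<close>

text \<open>
  This is the result of testing the differential inequality with \<open>u\<^sup>-\<^sup>\<alpha> \<phi>\<^sup>k\<close>.  For
  \<open>\<alpha> > 0\<close> the derivative of \<open>u\<^sup>-\<^sup>\<alpha>\<close> has a favourable sign and puts the
  weighted energies \<open>u\<^sup>-\<^sup>\<alpha>\<^sup>-\<^sup>1 (\<bar>\<nabla>u\<bar>\<^sup>p + \<bar>\<nabla>u\<bar>\<^sup>q)\<close> on the left-hand side;
  for \<open>\<alpha> = 0\<close> the plain reaction term \<open>u\<^sup>s \<bar>\<nabla>u\<bar>\<^sup>m\<close> is bounded by boundary-layer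
  terms alone.
\<close>

lemma energy_inequality:
  fixes u \<phi> :: "'a::euclidean_space \<Rightarrow> real" and k :: nat
  assumes sol: "positive_solution p q s m u" and "1 < p" "1 < q" "0 < m" "2 \<le> k"
    and \<phi>: "C1 \<phi>" "\<And>x. 0 \<le> \<phi> x" "\<And>x. x \<notin> cball 0 \<rho> \<Longrightarrow> \<phi> x = 0"
  defines "g \<equiv> \<lambda>x. norm (grad u x)"
  shows "\<alpha> * (\<integral>x. u x powr (-\<alpha> - 1) * (g x powr p + g x powr q) * \<phi> x ^ k \<partial>lborel)
       + (\<integral>x. u x powr (s - \<alpha>) * g x powr m * \<phi> x ^ k \<partial>lborel)
    \<le> (\<integral>x. k * (u x powr (-\<alpha>) * (g x powr (p - 1) + g x powr (q - 1)) * \<phi> x ^ (k - 1)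
             * norm (grad \<phi> x)) \<partial>lborel)"
proof -
  have u_diff: "u differentiable (at x)" and u_pos: "0 < u x"
    and \<phi>_diff: "\<phi> differentiable (at x)" for x
    using sol \<phi>(1) by (auto simp: positive_solution_def C1_def)
  have cont_grad: "continuous_on UNIV (grad u)" "continuous_on UNIV (grad \<phi>)"
    using sol \<phi>(1) by (auto simp: positive_solution_def C1_def)
  have C1_u: "C1 u" using sol by (simp add: positive_solution_def)
  note cont = C1_continuous[OF C1_u] C1_continuous[OF \<phi>(1)]
  note cont_u_powr = continuous_on_positive_powr[OF C1_u u_pos]
  have cont_g_powr: "continuous_on UNIV (\<lambda>x. g x powr a)" if "a > 0" for a
    unfolding g_def by (rule continuous_on_norm_grad_powr[OF C1_u that])
  define \<eta> where "\<eta> = (\<lambda>x. u x powr (-\<alpha>) * \<phi> x ^ k)"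
  define D where "D = (\<lambda>x. (u x powr (-\<alpha>) * (k * \<phi> x ^ (k - 1))) *\<^sub>R grad \<phi> x
       - (\<alpha> * u x powr (-\<alpha> - 1) * \<phi> x ^ k) *\<^sub>R grad u x)"
  have GD: "GDERIV \<eta> x :> D x" for x
  proof -
    have "DERIV (\<lambda>t. t powr (-\<alpha>)) (u x) :> -\<alpha> * u x powr (-\<alpha> - 1)"
      using u_pos by (rule has_real_derivative_powr)
    then have 1: "GDERIV (\<lambda>x. u x powr (-\<alpha>)) x :> (-\<alpha> * u x powr (-\<alpha> - 1)) *\<^sub>R grad u x"
      by (rule GDERIV_DERIV_compose[OF GDERIV_grad[OF u_diff]])
    have "DERIV (\<lambda>t. t ^ k) (\<phi> x) :> k * \<phi> x ^ (k - 1)"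
      by (auto intro!: derivative_eq_intros)
    then have 2: "GDERIV (\<lambda>x. \<phi> x ^ k) x :> (k * \<phi> x ^ (k - 1)) *\<^sub>R grad \<phi> x"
      by (rule GDERIV_DERIV_compose[OF GDERIV_grad[OF \<phi>_diff]])
    show ?thesis
      unfolding \<eta>_def by (rule GDERIV_subst[OF GDERIV_mult[OF 1 2]]) (simp add: D_def mult_ac)
  qed
  have grad_\<eta>: "grad \<eta> = D"
    using grad_eqI[OF GD] by auto
  have cont_D: "continuous_on UNIV D"
    unfolding D_def by (intro continuous_intros cont cont_grad cont_u_powr)
  have "C1 \<eta>"
    using GD cont_D unfolding C1_def grad_\<eta> gderiv_def differentiable_def by blast
  moreover have "compact (closure (support_on UNIV \<eta>))"
  proof -
    have "support_on UNIV \<eta> \<subseteq> cball 0 \<rho>"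
    proof
      fix x assume "x \<in> support_on UNIV \<eta>"
      then have "\<phi> x \<noteq> 0" using \<open>2 \<le> k\<close> by (auto simp: support_on_def \<eta>_def)
      then show "x \<in> cball 0 \<rho>" using \<phi>(3) by blast
    qed
    then show ?thesis
      by (meson bounded_cball bounded_subset compact_closure)
  qed
  ultimately have "C1_compact_support \<eta>"
    by (simp add: C1_compact_support_def)
  moreover have "\<forall>x. \<eta> x \<ge> 0"
    by (simp add: \<eta>_def \<phi>(2))
  ultimately have test: "(\<integral>x. u x powr s * g x powr m * \<eta> x \<partial>lborel)
      \<le> (\<integral>x. inner (flux p u x) (D x) \<partial>lborel) + (\<integral>x. inner (flux q u x) (D x) \<partial>lborel)"
    using sol unfolding positive_solution_def g_def grad_\<eta>[symmetric] by blast
  have weight: "u x powr s * g x powr m * \<eta> x = u x powr (s - \<alpha>) * g x powr m * \<phi> x ^ k" for x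
    using u_pos[of x] by (simp add: \<eta>_def powr_diff powr_minus field_simps)
  define P where "P = (\<lambda>r x. u x powr (-\<alpha> - 1) * g x powr r * \<phi> x ^ k)"
  define B where "B = (\<lambda>r x. u x powr (-\<alpha>) * g x powr (r - 1) * \<phi> x ^ (k - 1) * norm (grad \<phi> x))"
  have int_P: "integrable lborel (P r)" if "r > 1" for r
  proof (rule integrable_continuous_compact_support)
    show "continuous_on UNIV (P r)"
      unfolding P_def using that by (intro continuous_intros cont cont_u_powr cont_g_powr) auto
    show "\<And>x. x \<notin> cball 0 \<rho> \<Longrightarrow> P r x = 0"
      using \<phi>(3) \<open>2 \<le> k\<close> by (simp add: P_def)
  qed
  have int_B: "integrable lborel (B r)" if "r > 1" for r
  proof (rule integrable_continuous_compact_support)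
    show "continuous_on UNIV (B r)"
      unfolding B_def using that
      by (intro continuous_intros cont cont_grad cont_u_powr cont_g_powr) auto
    show "\<And>x. x \<notin> cball 0 \<rho> \<Longrightarrow> B r x = 0"
      using \<phi>(3) \<open>2 \<le> k\<close> by (simp add: B_def)
  qed
  have flux_bound: "(\<integral>x. inner (flux r u x) (D x) \<partial>lborel)
      \<le> k * (\<integral>x. B r x \<partial>lborel) - \<alpha> * (\<integral>x. P r x \<partial>lborel)" if "r > 1" for r
  proof -
    have norm_flux: "norm (flux r u x) = g x powr (r - 1)" for x
    proof (cases "g x = 0")
      case True
      then show ?thesis by (simp add: flux_def g_def)
    next
      case False
      then have "g x > 0" by (simp add: g_def)
      moreover have "norm (flux r u x) = g x powr (r - 2) * g x"
        by (simp add: flux_def g_def)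
      ultimately show ?thesis
        by (simp add: powr_diff power2_eq_square)
    qed
    have flux_grad: "inner (flux r u x) (grad u x) = g x powr r" for x
    proof (cases "g x = 0")
      case True
      then show ?thesis by (simp add: flux_def g_def)
    next
      case False
      then have "g x > 0" by (simp add: g_def)
      moreover have "inner (flux r u x) (grad u x) = g x powr (r - 2) * (g x)\<^sup>2"
        by (simp add: flux_def g_def power2_norm_eq_inner)
      ultimately show ?thesis
        by (simp add: powr_diff)
    qed
    have bound: "inner (flux r u x) (D x) \<le> k * B r x - \<alpha> * P r x" for x
    proof -
      have "inner (flux r u x) (D x)
          = u x powr (-\<alpha>) * (k * \<phi> x ^ (k - 1)) * inner (flux r u x) (grad \<phi> x) - \<alpha> * P r x"
        by (simp add: D_def inner_diff_right flux_grad P_def mult_ac)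
      moreover have "inner (flux r u x) (grad \<phi> x) \<le> g x powr (r - 1) * norm (grad \<phi> x)"
        using norm_cauchy_schwarz[of "flux r u x" "grad \<phi> x"] by (simp add: norm_flux)
      then have "u x powr (-\<alpha>) * (k * \<phi> x ^ (k - 1)) * inner (flux r u x) (grad \<phi> x)
          \<le> u x powr (-\<alpha>) * (k * \<phi> x ^ (k - 1)) * (g x powr (r - 1) * norm (grad \<phi> x))"
        by (rule mult_left_mono) (simp add: \<phi>(2))
      ultimately show ?thesis by (simp add: B_def mult_ac)
    qed
    \<comment> \<open>Domination by \<open>\<bar>\<nabla>u\<bar>\<^sup>r\<^sup>-\<^sup>1 \<bar>D\<bar>\<close> makes it enough that the flux is measurable, although
      its defining formula is singular at the critical points of \<open>u\<close> when \<open>r < 2\<close>.\<close>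
    have "integrable lborel (\<lambda>x. inner (flux r u x) (D x))"
    proof (rule Bochner_Integration.integrable_bound)
      show "integrable lborel (\<lambda>x. g x powr (r - 1) * norm (D x))"
      proof (rule integrable_continuous_compact_support)
        show "continuous_on UNIV (\<lambda>x. g x powr (r - 1) * norm (D x))"
          using that by (intro continuous_intros cont_D cont_g_powr) auto
        show "\<And>x. x \<notin> cball 0 \<rho> \<Longrightarrow> g x powr (r - 1) * norm (D x) = 0"
          using \<phi>(3) \<open>2 \<le> k\<close> by (simp add: D_def zero_power)
      qed
      have [measurable]: "grad u \<in> borel_measurable borel" "D \<in> borel_measurable borel"
        using cont_grad(1) cont_D by (auto intro: borel_measurable_continuous_onI)
      show "(\<lambda>x. inner (flux r u x) (D x)) \<in> borel_measurable lborel"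
        unfolding flux_def by measurable
      show "AE x in lborel. norm (inner (flux r u x) (D x)) \<le> norm (g x powr (r - 1) * norm (D x))"
        using Cauchy_Schwarz_ineq2 by (intro AE_I2) (simp flip: norm_flux)
    qed
    then have "(\<integral>x. inner (flux r u x) (D x) \<partial>lborel) \<le> (\<integral>x. k * B r x - \<alpha> * P r x \<partial>lborel)"
      by (intro integral_mono bound Bochner_Integration.integrable_diff integrable_mult_right int_P int_B that)
    then show ?thesis
      using int_P[OF that] int_B[OF that] by simp
  qed
  have "(\<integral>x. u x powr (-\<alpha> - 1) * (g x powr p + g x powr q) * \<phi> x ^ k \<partial>lborel)
      = (\<integral>x. P p x + P q x \<partial>lborel)"
    by (simp add: P_def algebra_simps)
  also have "\<dots> = (\<integral>x. P p x \<partial>lborel) + (\<integral>x. P q x \<partial>lborel)"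
    using int_P \<open>1 < p\<close> \<open>1 < q\<close> by simp
  finally have P: "(\<integral>x. u x powr (-\<alpha> - 1) * (g x powr p + g x powr q) * \<phi> x ^ k \<partial>lborel) = \<dots>" .
  have "(\<integral>x. k * (u x powr (-\<alpha>) * (g x powr (p - 1) + g x powr (q - 1)) * \<phi> x ^ (k - 1)
             * norm (grad \<phi> x)) \<partial>lborel) = (\<integral>x. k * (B p x + B q x) \<partial>lborel)"
    by (simp add: B_def algebra_simps)
  also have "\<dots> = k * (\<integral>x. B p x \<partial>lborel) + k * (\<integral>x. B q x \<partial>lborel)"
    using int_B \<open>1 < p\<close> \<open>1 < q\<close> by (simp add: algebra_simps)
  finally show ?thesis
    using test flux_bound[OF \<open>1 < p\<close>] flux_bound[OF \<open>1 < q\<close>]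
    unfolding weight P by (simp add: algebra_simps)
qed

section \<open>Growth of the energies\<close>

lemma integrable_cutoff_weight:
  fixes u :: "'a::euclidean_space \<Rightarrow> real"
  assumes "C1 u" "\<And>x. 0 < u x" "0 < b" "0 < R" "0 < k"
  shows "integrable lborel (\<lambda>x. u x powr a * norm (grad u x) powr b * cutoff R x ^ k)"
proof (rule integrable_continuous_compact_support)
  show "continuous_on UNIV (\<lambda>x. u x powr a * norm (grad u x) powr b * cutoff R x ^ k)"
    using assms by (intro continuous_intros continuous_on_positive_powr continuous_on_norm_grad_powr
        C1_continuous C1_cutoff) auto
  show "\<And>x. x \<notin> cball 0 (2 * R) \<Longrightarrow> u x powr a * norm (grad u x) powr b * cutoff R x ^ k = 0"
    using assms by (simp add: cutoff_eq_0_outside)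
qed

lemma integrable_cutoff_energy:
  fixes u :: "'a::euclidean_space \<Rightarrow> real"
  assumes "C1 u" "\<And>x. 0 < u x" "0 < b" "0 < c" "0 < R" "0 < k"
  shows "integrable lborel
    (\<lambda>x. u x powr a * (norm (grad u x) powr b + norm (grad u x) powr c) * cutoff R x ^ k)"
  using Bochner_Integration.integrable_add[OF integrable_cutoff_weight[OF assms(1,2,3,5,6), of a]
      integrable_cutoff_weight[OF assms(1,2,4,5,6), of a]]
  by (simp add: algebra_simps)

lemma integrable_indicator_cball:
  "integrable lborel (indicator (cball 0 \<rho>) :: 'a::euclidean_space \<Rightarrow> real)"
  using emeasure_lborel_cball_finite[of "0::'a" \<rho>] by (intro integrable_real_indicator) auto

lemma integral_indicator_cball:
  assumes "0 < R"
  shows "(\<integral>x. indicator (cball (0::'a::euclidean_space) (2 * R)) x \<partial>lborel)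
    = unit_ball_vol (DIM('a)) * 2 ^ DIM('a) * R powr DIM('a)"
proof -
  have "(\<integral>x. indicator (cball (0::'a) (2 * R)) x \<partial>lborel) = measure lborel (cball (0::'a) (2 * R))"
    by simp
  also have "\<dots> = unit_ball_vol (DIM('a)) * (2 * R) ^ DIM('a)"
    using assms by (intro content_cball) simp
  finally show ?thesis using assms by (simp add: power_mult_distrib powr_realpow)
qed

text \<open>
  In the energy inequality for \<open>u\<^sup>-\<^sup>\<alpha> \<phi>\<^sup>k\<close>, Young's inequality splits each boundary-layer
  term into small multiples of both terms on the left, which are absorbed, and a power of \<open>R\<close>
  integrated over a ball of radius \<open>2 R\<close>.  The exponents \<open>p\<close> and \<open>q\<close> give different
  powers, and the worse one governs the growth as \<open>R \<rightarrow> \<infinity>\<close>.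
\<close>

lemma weighted_energy_growth:
  fixes u :: "'a::euclidean_space \<Rightarrow> real"
  assumes sol: "positive_solution p q s m u"
    and par: "1 < q" "q < p" "p - 1 < m" "0 \<le> s" "0 < \<alpha>" "\<alpha> < q - 1" "p * \<alpha> < m"
  defines "e \<equiv> \<lambda>r. (r * s + m + (m - r) * \<alpha>) / (s + m - r + 1)"
  shows "\<forall>\<^sub>F k in sequentially. \<exists>C\<ge>0. \<forall>R\<ge>1.
    (\<integral>x. u x powr (-\<alpha> - 1) * (norm (grad u x) powr p + norm (grad u x) powr q) * cutoff R x ^ k \<partial>lborel)
      \<le> C * R powr (real DIM('a) - min (e p) (e q))"
proof -
  define g where "g x = norm (grad u x)" for x
  have u: "C1 u" and u_pos: "0 < u x" for x
    using sol by (auto simp: positive_solution_def)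
  have "q * \<alpha> < m"
    using par mult_strict_right_mono[of q p \<alpha>] by linarith
  then have
    "\<forall>\<^sub>F k in sequentially. \<forall>\<epsilon>>0. \<exists>C>0. \<forall>R>0. \<forall>y>0. \<forall>g\<ge>0. \<forall>f\<in>{0..1}.
     1 / R * (y powr (-\<alpha>) * g powr (r - 1) * f ^ (k - 1))
     \<le> \<epsilon> * (y powr (-\<alpha> - 1) * g powr r * f ^ k) + \<epsilon> * (y powr (s - \<alpha>) * g powr m * f ^ k)
       + C * R powr (- e r)" if "r \<in> {p, q}" for r :: real
    unfolding e_def using par that by (intro young_with_weight) auto
  from this[OF insertI1] this[OF insertI2[OF singletonI]] eventually_ge_at_top[of 2] show ?thesis
  proof eventually_elim
    case (elim k)
    note young = elim(1,2) and k = elim(3)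
    \<comment> \<open>The gradient of the cut-off contributes \<open>16\<close>.  With this \<open>\<epsilon>\<close> the boundary layer uses up
      at most half of the weighted energy and all of the reaction term.\<close>
    define \<epsilon> where "\<epsilon> = min \<alpha> 1 / (32 * real k)"
    have "\<epsilon> > 0" using par k by (simp add: \<epsilon>_def)
    have \<epsilon>: "32 * real k * \<epsilon> = min \<alpha> 1" using k by (simp add: \<epsilon>_def)
    obtain Cp where "Cp > 0" and Cp: "\<forall>R>0. \<forall>y>0. \<forall>g\<ge>0. \<forall>f\<in>{0..1}.
     1 / R * (y powr (-\<alpha>) * g powr (p - 1) * f ^ (k - 1))
     \<le> \<epsilon> * (y powr (-\<alpha> - 1) * g powr p * f ^ k) + \<epsilon> * (y powr (s - \<alpha>) * g powr m * f ^ k)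
       + Cp * R powr (- e p)"
      using young(1)[rule_format, OF \<open>\<epsilon> > 0\<close>] by auto
    obtain Cq where "Cq > 0" and Cq: "\<forall>R>0. \<forall>y>0. \<forall>g\<ge>0. \<forall>f\<in>{0..1}.
     1 / R * (y powr (-\<alpha>) * g powr (q - 1) * f ^ (k - 1))
     \<le> \<epsilon> * (y powr (-\<alpha> - 1) * g powr q * f ^ k) + \<epsilon> * (y powr (s - \<alpha>) * g powr m * f ^ k)
       + Cq * R powr (- e q)"
      using young(2)[rule_format, OF \<open>\<epsilon> > 0\<close>] by auto
    define V where "V = unit_ball_vol (DIM('a)) * 2 ^ DIM('a)"
    have "V \<ge> 0" by (simp add: V_def)
    show ?case
    proof (intro exI[of _ "32 * real k / \<alpha> * (Cp + Cq) * V"] conjI allI impI)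
      show "0 \<le> 32 * real k / \<alpha> * (Cp + Cq) * V"
        using par \<open>Cp > 0\<close> \<open>Cq > 0\<close> \<open>V \<ge> 0\<close> by simp
      fix R :: real
      assume "1 \<le> R"
      then have R: "R > 0" by simp
      let ?\<phi> = "cutoff R :: 'a \<Rightarrow> real"
      define A where "A x = u x powr (-\<alpha> - 1) * (g x powr p + g x powr q) * ?\<phi> x ^ k" for x
      define W where "W x = u x powr (s - \<alpha>) * g x powr m * ?\<phi> x ^ k" for x
      define c where "c = 16 * real k * ((Cp + Cq) * R powr (- min (e p) (e q)))"
      let ?\<chi> = "indicator (cball (0::'a) (2 * R)) :: 'a \<Rightarrow> real"
      have A_nonneg: "0 \<le> A x" and W_nonneg: "0 \<le> W x" for x
        by (auto simp: A_def W_def cutoff_nonneg)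
      have "c \<ge> 0" using \<open>Cp > 0\<close> \<open>Cq > 0\<close> by (simp add: c_def)
      have intA: "integrable lborel A"
        unfolding A_def[abs_def] g_def using u u_pos R k par
        by (intro integrable_cutoff_energy) auto
      have intW: "integrable lborel W"
        unfolding W_def[abs_def] g_def using u u_pos R k par by (intro integrable_cutoff_weight) auto
      have pointwise: "k * (u x powr (-\<alpha>) * (g x powr (p - 1) + g x powr (q - 1)) * ?\<phi> x ^ (k - 1)
             * norm (grad ?\<phi> x)) \<le> \<alpha> / 2 * A x + W x + c * ?\<chi> x" for x
      proof (cases "x \<in> cball 0 (2 * R)")
        case False
        then have "?\<phi> x = 0" by (rule cutoff_eq_0_outside[OF R])
        moreover have "0 \<le> \<alpha> / 2 * A x + W x + c * ?\<chi> x"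
          using A_nonneg W_nonneg par \<open>c \<ge> 0\<close> by simp
        ultimately show ?thesis using k by (simp add: zero_power)
      next
        case True
        let ?B = "\<lambda>r. u x powr (-\<alpha>) * g x powr (r - 1) * ?\<phi> x ^ (k - 1)"
        have \<phi>: "?\<phi> x \<in> {0..1}" by (simp add: cutoff_nonneg cutoff_le_1)
        have g: "0 \<le> g x" by (simp add: g_def)
        have "norm (grad ?\<phi> x) \<le> 16 * (1 / R)"
          using norm_grad_cutoff_le[OF R, of x] by simp
        then have "k * ((?B p + ?B q) * norm (grad ?\<phi> x)) \<le> k * ((?B p + ?B q) * (16 * (1 / R)))"
          by (intro mult_left_mono) (auto simp: cutoff_nonneg)
        also have "\<dots> = 16 * real k * (1 / R * ?B p + 1 / R * ?B q)"
          by (simp add: algebra_simps)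
        also have "\<dots> \<le> 16 * real k * ((\<epsilon> * (u x powr (-\<alpha> - 1) * g x powr p * ?\<phi> x ^ k) + \<epsilon> * W x
               + Cp * R powr (- min (e p) (e q))) +
             (\<epsilon> * (u x powr (-\<alpha> - 1) * g x powr q * ?\<phi> x ^ k) + \<epsilon> * W x
               + Cq * R powr (- min (e p) (e q))))"
        proof (intro mult_left_mono add_mono)
          have "Cp * R powr (- e p) \<le> Cp * R powr (- min (e p) (e q))"
            using \<open>Cp > 0\<close> \<open>1 \<le> R\<close> by (intro mult_left_mono powr_mono) auto
          with Cp[rule_format, OF R u_pos[of x] g \<phi>]
          show "1 / R * ?B p \<le> \<epsilon> * (u x powr (-\<alpha> - 1) * g x powr p * ?\<phi> x ^ k) + \<epsilon> * W x
               + Cp * R powr (- min (e p) (e q))"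
            unfolding W_def by linarith
          have "Cq * R powr (- e q) \<le> Cq * R powr (- min (e p) (e q))"
            using \<open>Cq > 0\<close> \<open>1 \<le> R\<close> by (intro mult_left_mono powr_mono) auto
          with Cq[rule_format, OF R u_pos[of x] g \<phi>]
          show "1 / R * ?B q \<le> \<epsilon> * (u x powr (-\<alpha> - 1) * g x powr q * ?\<phi> x ^ k) + \<epsilon> * W x
               + Cq * R powr (- min (e p) (e q))"
            unfolding W_def by linarith
        qed simp
        also have "\<dots> = (32 * real k * \<epsilon>) / 2 * A x + (32 * real k * \<epsilon>) * W x + c"
          by (simp add: A_def c_def algebra_simps)
        also have "\<dots> \<le> \<alpha> / 2 * A x + 1 * W x + c"
          unfolding \<epsilon> using A_nonneg W_nonneg by (intro add_mono mult_right_mono) auto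
        finally show ?thesis using True by (simp add: algebra_simps)
      qed
      have "\<alpha> * (\<integral>x. A x \<partial>lborel) + (\<integral>x. W x \<partial>lborel)
        \<le> (\<integral>x. k * (u x powr (-\<alpha>) * (g x powr (p - 1) + g x powr (q - 1)) * ?\<phi> x ^ (k - 1)
             * norm (grad ?\<phi> x)) \<partial>lborel)"
        unfolding A_def W_def g_def using par k R
        by (intro energy_inequality[OF sol, where \<rho> = "2 * R"] C1_cutoff cutoff_nonneg
            cutoff_eq_0_outside) auto
      also have "\<dots> \<le> (\<integral>x. \<alpha> / 2 * A x + W x + c * ?\<chi> x \<partial>lborel)"
      proof (rule integral_mono')
        show "integrable lborel (\<lambda>x. \<alpha> / 2 * A x + W x + c * ?\<chi> x)"
          by (intro Bochner_Integration.integrable_add integrable_mult_right intA intW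
              integrable_indicator_cball)
      qed (use pointwise A_nonneg W_nonneg par \<open>c \<ge> 0\<close> in auto)
      also have "\<dots> = \<alpha> / 2 * (\<integral>x. A x \<partial>lborel) + (\<integral>x. W x \<partial>lborel) + c * (V * R powr DIM('a))"
        using intA intW integrable_indicator_cball[of "2 * R", where ?'a = 'a]
          integral_indicator_cball[OF R, where ?'a = 'a] by (simp add: V_def)
      finally have "\<alpha> / 2 * (\<integral>x. A x \<partial>lborel) \<le> c * (V * R powr DIM('a))"
        by (simp add: field_simps)
      then have "(\<integral>x. A x \<partial>lborel) \<le> 2 / \<alpha> * (c * (V * R powr DIM('a)))"
        using par by (simp add: field_simps)
      also have "\<dots> = 32 * real k / \<alpha> * (Cp + Cq) * V * (R powr DIM('a) * R powr (- min (e p) (e q)))"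
        by (simp add: c_def)
      also have "R powr DIM('a) * R powr (- min (e p) (e q)) = R powr (real DIM('a) - min (e p) (e q))"
        by (simp add: powr_add[symmetric])
      finally show "(\<integral>x. u x powr (-\<alpha> - 1) * (norm (grad u x) powr p + norm (grad u x) powr q)
          * ?\<phi> x ^ k \<partial>lborel)
        \<le> 32 * real k / \<alpha> * (Cp + Cq) * V * R powr (real DIM('a) - min (e p) (e q))"
        by (simp add: A_def g_def)
    qed
  qed
qed

text \<open>
  In the energy inequality for \<open>\<phi>\<^sup>k\<close> itself, the right-hand side lives where
  \<open>\<nabla>\<phi> \<noteq> 0\<close>, that is, outside the ball of radius \<open>R\<close>.  The reaction term that
  Young's inequality produces is therefore kept restricted to this layer, while the other two
  terms are bounded uniformly in \<open>R\<close> thanks to the growth of the weighted energy.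
\<close>

lemma absorption_estimate:
  fixes u :: "'a::euclidean_space \<Rightarrow> real"
  assumes sol: "positive_solution p q s m u"
    and par: "1 < q" "q < p" "p - 1 < m" "0 \<le> s" "0 < \<alpha>"
    and growth: "\<forall>\<^sub>F k in sequentially. \<exists>C\<ge>0. \<forall>R\<ge>1.
      (\<integral>x. u x powr (-\<alpha> - 1) * (norm (grad u x) powr p + norm (grad u x) powr q) * cutoff R x ^ k \<partial>lborel)
      \<le> C * R powr \<kappa>"
    and scaling: "\<And>r::real. r \<in> {p, q} \<Longrightarrow>
      \<kappa> * ((r - 1) * s) + DIM('a) * (r * s + m * (1 + \<alpha>) - (r - 1) * (1 + \<alpha> + s))
        \<le> r * s + m * (1 + \<alpha>)"
  defines "w \<equiv> \<lambda>x. u x powr s * norm (grad u x) powr m"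
  shows "\<forall>\<^sub>F k in sequentially. \<exists>M\<ge>0. \<exists>\<gamma>>0. \<exists>\<gamma>'>0. \<forall>t>0. \<forall>C.
    t powr (-\<gamma>) \<le> C \<longrightarrow> t powr (-\<gamma>') \<le> C \<longrightarrow>
    (\<forall>R\<ge>1. (\<integral>x. w x * cutoff R x ^ k \<partial>lborel)
      \<le> M * t + M * C * (\<integral>x. indicator (- cball 0 R) x * (w x * cutoff R x ^ k) \<partial>lborel))"
proof -
  define g where "g x = norm (grad u x)" for x
  define N where "N = real DIM('a)"
  have u: "C1 u" and u_pos: "0 < u x" for x
    using sol by (auto simp: positive_solution_def)
  have "\<forall>\<^sub>F k in sequentially. \<exists>\<gamma>>0. \<forall>t>0. \<forall>C\<ge>t powr (-\<gamma>). \<forall>R\<ge>1. \<forall>y>0. \<forall>g\<ge>0. \<forall>f\<in>{0..1}.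
     1 / R * (g powr (r - 1) * f ^ (k - 1))
     \<le> t * R powr (-\<kappa>) * (y powr (-\<alpha> - 1) * g powr r * f ^ k)
       + C * (y powr s * g powr m * f ^ k) + t * R powr (- N)" if "r \<in> {p, q}" for r :: real
    using par that scaling[OF that] unfolding N_def by (intro young_without_weight) auto
  from this[OF insertI1] this[OF insertI2[OF singletonI]] growth eventually_ge_at_top[of 2] show ?thesis
  proof eventually_elim
    case (elim k)
    note k = elim(4)
    obtain \<gamma>p where "\<gamma>p > 0" and young_p:
      "\<forall>t>0. \<forall>C\<ge>t powr (-\<gamma>p). \<forall>R\<ge>1. \<forall>y>0. \<forall>g\<ge>0. \<forall>f\<in>{0..1}.
     1 / R * (g powr (p - 1) * f ^ (k - 1))
     \<le> t * R powr (-\<kappa>) * (y powr (-\<alpha> - 1) * g powr p * f ^ k)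
       + C * (y powr s * g powr m * f ^ k) + t * R powr (- N)"
      using elim(1) by blast
    obtain \<gamma>q where "\<gamma>q > 0" and young_q:
      "\<forall>t>0. \<forall>C\<ge>t powr (-\<gamma>q). \<forall>R\<ge>1. \<forall>y>0. \<forall>g\<ge>0. \<forall>f\<in>{0..1}.
     1 / R * (g powr (q - 1) * f ^ (k - 1))
     \<le> t * R powr (-\<kappa>) * (y powr (-\<alpha> - 1) * g powr q * f ^ k)
       + C * (y powr s * g powr m * f ^ k) + t * R powr (- N)"
      using elim(2) by blast
    obtain C1 where "C1 \<ge> 0" and C1: "\<And>R. R \<ge> 1 \<Longrightarrow>
        (\<integral>x. u x powr (-\<alpha> - 1) * (g x powr p + g x powr q) * cutoff R x ^ k \<partial>lborel)
        \<le> C1 * R powr \<kappa>"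
      using elim(3) unfolding g_def by auto
    define V where "V = unit_ball_vol (DIM('a)) * 2 ^ DIM('a)"
    have "V \<ge> 0" by (simp add: V_def)
    define M where "M = 32 * real k * (C1 + V + 1)"
    show ?case
    proof (rule exI[of _ M],
        rule conjI[OF _ exI[of _ \<gamma>p, OF conjI[OF _ exI[of _ \<gamma>q, OF conjI]]]]; (intro allI impI)?)
      show "M \<ge> 0" "\<gamma>p > 0" "\<gamma>q > 0"
        using \<open>C1 \<ge> 0\<close> \<open>V \<ge> 0\<close> \<open>\<gamma>p > 0\<close> \<open>\<gamma>q > 0\<close> by (auto simp: M_def)
      fix t C R :: real
      assume t: "0 < t" and C: "t powr (-\<gamma>p) \<le> C" "t powr (-\<gamma>q) \<le> C" and R1: "1 \<le> R"
      then have R: "R > 0" by simp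
      have "C \<ge> 0" using C(1) by (smt (verit) powr_ge_zero)
      let ?\<phi> = "cutoff R :: 'a \<Rightarrow> real"
      define A where "A x = u x powr (-\<alpha> - 1) * (g x powr p + g x powr q) * ?\<phi> x ^ k" for x
      define W where "W x = w x * ?\<phi> x ^ k" for x
      define J where "J x = indicator (- cball 0 R) x * W x" for x
      let ?\<chi> = "indicator (cball (0::'a) (2 * R)) :: 'a \<Rightarrow> real"
      have A_nonneg: "0 \<le> A x" and W_nonneg: "0 \<le> W x" and J_nonneg: "0 \<le> J x" for x
        by (auto simp: A_def W_def w_def J_def cutoff_nonneg)
      have intA: "integrable lborel A"
        unfolding A_def[abs_def] g_def using u u_pos R k par
        by (intro integrable_cutoff_energy) auto
      have intW: "integrable lborel W"
        unfolding W_def[abs_def] w_def using u u_pos R k par by (intro integrable_cutoff_weight) auto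
      have intJ: "integrable lborel J"
      proof -
        have "integrable lborel (\<lambda>x. indicator (- cball 0 R) x *\<^sub>R W x)"
          by (intro integrable_mult_indicator intW) auto
        then show ?thesis by (simp add: J_def[abs_def])
      qed
      define a where "a = 16 * real k * (t * R powr (-\<kappa>))"
      define b where "b = 32 * real k * (t * R powr (-N))"
      define d where "d = 32 * real k * C"
      have abd: "0 \<le> a" "0 \<le> b" "0 \<le> d" using t \<open>C \<ge> 0\<close> by (auto simp: a_def b_def d_def)
      have pointwise: "k * (u x powr (-0) * (g x powr (p - 1) + g x powr (q - 1)) * ?\<phi> x ^ (k - 1)
             * norm (grad ?\<phi> x)) \<le> a * A x + d * J x + b * ?\<chi> x" for x
      proof -
        consider "norm x \<le> R" | "x \<notin> cball 0 (2 * R)" | "x \<in> - cball 0 R" "x \<in> cball 0 (2 * R)"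
          by fastforce
        then show ?thesis
        proof cases
          case 1
          then have "grad ?\<phi> x = 0" by (rule grad_cutoff_eq_0[OF R])
          then show ?thesis using A_nonneg J_nonneg abd by simp
        next
          case 2
          then have "?\<phi> x = 0" by (rule cutoff_eq_0_outside[OF R])
          moreover have "0 \<le> a * A x + d * J x + b * ?\<chi> x"
            using A_nonneg J_nonneg abd by simp
          ultimately show ?thesis using k by (simp add: zero_power)
        next
          case 3
          let ?B = "\<lambda>r. g x powr (r - 1) * ?\<phi> x ^ (k - 1)"
          have \<phi>: "?\<phi> x \<in> {0..1}" by (simp add: cutoff_nonneg cutoff_le_1)
          have g: "0 \<le> g x" by (simp add: g_def)
          have "norm (grad ?\<phi> x) \<le> 16 * (1 / R)"
            using norm_grad_cutoff_le[OF R, of x] by simp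
          then have "k * ((?B p + ?B q) * norm (grad ?\<phi> x)) \<le> k * ((?B p + ?B q) * (16 * (1 / R)))"
            by (intro mult_left_mono) (auto simp: cutoff_nonneg)
          also have "\<dots> = 16 * real k * (1 / R * ?B p + 1 / R * ?B q)"
            by (simp add: algebra_simps)
          also have "\<dots> \<le> 16 * real k * ((t * R powr (-\<kappa>) * (u x powr (-\<alpha> - 1) * g x powr p * ?\<phi> x ^ k)
                + C * W x + t * R powr (- N)) +
              (t * R powr (-\<kappa>) * (u x powr (-\<alpha> - 1) * g x powr q * ?\<phi> x ^ k)
                + C * W x + t * R powr (- N)))"
            using young_p[rule_format, OF t C(1) R1 u_pos[of x] g \<phi>]
              young_q[rule_format, OF t C(2) R1 u_pos[of x] g \<phi>]
            unfolding W_def w_def g_def[symmetric] by (intro mult_left_mono add_mono) auto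
          also have "\<dots> = a * A x + d * W x + b"
            by (simp add: A_def a_def b_def d_def algebra_simps)
          finally show ?thesis using 3 u_pos[of x] by (simp add: J_def algebra_simps)
        qed
      qed
      have "0 * (\<integral>x. u x powr (-0 - 1) * (g x powr p + g x powr q) * ?\<phi> x ^ k \<partial>lborel)
          + (\<integral>x. u x powr (s - 0) * g x powr m * ?\<phi> x ^ k \<partial>lborel)
        \<le> (\<integral>x. k * (u x powr (-0) * (g x powr (p - 1) + g x powr (q - 1)) * ?\<phi> x ^ (k - 1)
             * norm (grad ?\<phi> x)) \<partial>lborel)"
        unfolding g_def using par k R
        by (intro energy_inequality[OF sol, where \<rho> = "2 * R"] C1_cutoff cutoff_nonneg
            cutoff_eq_0_outside) auto
      also have "\<dots> \<le> (\<integral>x. a * A x + d * J x + b * ?\<chi> x \<partial>lborel)"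
      proof (rule integral_mono')
        show "integrable lborel (\<lambda>x. a * A x + d * J x + b * ?\<chi> x)"
          by (intro Bochner_Integration.integrable_add integrable_mult_right intA intJ
              integrable_indicator_cball)
      qed (use pointwise A_nonneg J_nonneg abd in auto)
      also have "\<dots> = a * (\<integral>x. A x \<partial>lborel) + d * (\<integral>x. J x \<partial>lborel) + b * (V * R powr N)"
        using intA intJ integrable_indicator_cball[of "2 * R", where ?'a = 'a]
          integral_indicator_cball[OF R, where ?'a = 'a] by (simp add: V_def N_def)
      also have "\<dots> \<le> a * (C1 * R powr \<kappa>) + d * (\<integral>x. J x \<partial>lborel) + b * (V * R powr N)"
        using C1[OF R1] abd by (intro add_right_mono mult_left_mono) (auto simp: A_def)
      also have "a * (C1 * R powr \<kappa>) = 16 * real k * C1 * t"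
        using R by (simp add: a_def powr_minus)
      also have "b * (V * R powr N) = 32 * real k * V * t"
        using R by (simp add: b_def powr_minus)
      also have "16 * real k * C1 * t + d * (\<integral>x. J x \<partial>lborel) + 32 * real k * V * t
          \<le> M * t + M * C * (\<integral>x. J x \<partial>lborel)"
      proof -
        have "16 * real k * C1 + 32 * real k * V \<le> M"
          using mult_nonneg_nonneg[of "real k" C1] \<open>C1 \<ge> 0\<close> by (simp add: M_def algebra_simps)
        then have "(16 * real k * C1 + 32 * real k * V) * t \<le> M * t"
          using t by (intro mult_right_mono) auto
        moreover have "32 * real k * 1 \<le> M"
          using \<open>C1 \<ge> 0\<close> \<open>V \<ge> 0\<close> unfolding M_def by (intro mult_left_mono) auto
        then have "d * (\<integral>x. J x \<partial>lborel) \<le> M * C * (\<integral>x. J x \<partial>lborel)"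
          unfolding d_def using \<open>C \<ge> 0\<close> J_nonneg by (intro mult_right_mono) auto
        ultimately show ?thesis by (simp add: algebra_simps)
      qed
      finally show "(\<integral>x. w x * ?\<phi> x ^ k \<partial>lborel)
        \<le> M * t + M * C * (\<integral>x. indicator (- cball 0 R) x * (w x * ?\<phi> x ^ k) \<partial>lborel)"
        by (simp add: J_def W_def w_def g_def)
    qed
  qed
qed

section \<open>Absorption and the Liouville property\<close>

text \<open>
  The absorption estimate is used twice.  A large \<open>t\<close> allows \<open>M C \<le> 1/2\<close>, so the layer
  integral is absorbed and \<open>w\<close> has finite integral over the whole space.  Consequently the
  integrals over dyadic layers tend to \<open>0\<close>, and for every fixed \<open>t\<close>, however small, the
  estimate bounds the total integral by \<open>M t\<close>.
\<close>

lemma absorption_imp_integral_nonpos: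
  fixes w :: "'a::euclidean_space \<Rightarrow> real"
  assumes cont: "continuous_on UNIV w" and nonneg: "\<And>x. 0 \<le> w x" and k: "0 < k"
    and M: "0 \<le> M" and \<gamma>: "0 < \<gamma>" "0 < \<gamma>'"
    and absorb: "\<And>t C R. 0 < t \<Longrightarrow> t powr (-\<gamma>) \<le> C \<Longrightarrow> t powr (-\<gamma>') \<le> C \<Longrightarrow> 1 \<le> R \<Longrightarrow>
      (\<integral>x. w x * cutoff R x ^ k \<partial>lborel)
        \<le> M * t + M * C * (\<integral>x. indicator (- cball 0 R) x * (w x * cutoff R x ^ k) \<partial>lborel)"
  shows "(\<integral>x. indicator (cball 0 (2 ^ j)) x * w x \<partial>lborel) \<le> 0"
proof -
  define a where "a = (\<lambda>j::nat. \<integral>x. indicator (cball 0 (2 ^ j)) x * w x \<partial>lborel)"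
  define I where "I = (\<lambda>R. \<integral>x. w x * cutoff R x ^ k \<partial>lborel)"
  define J where "J = (\<lambda>R. \<integral>x. indicator (- cball 0 R) x * (w x * cutoff R x ^ k) \<partial>lborel)"
  have int_ball: "integrable lborel (\<lambda>x. indicator (cball 0 \<rho>) x * w x)" for \<rho>
    using borel_integrable_compact[of "cball 0 \<rho>" w] continuous_on_subset[OF cont] by auto
  have int_cut: "integrable lborel (\<lambda>x. w x * cutoff R x ^ k)" if "R > 0" for R
  proof (rule integrable_continuous_compact_support)
    show "continuous_on UNIV (\<lambda>x. w x * cutoff R x ^ k)"
      by (intro continuous_intros cont C1_continuous C1_cutoff)
    show "\<And>x. x \<notin> cball 0 (2 * R) \<Longrightarrow> w x * cutoff R x ^ k = 0"
      using k that by (simp add: cutoff_eq_0_outside)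
  qed
  have cut_nonneg: "0 \<le> w x * cutoff R x ^ k" for R x
    by (simp add: nonneg cutoff_nonneg)
  have a_le_I: "a j \<le> I (2 ^ j)" for j
    unfolding a_def I_def
  proof (rule integral_mono'[OF int_cut])
    fix x :: 'a
    show "indicator (cball 0 (2 ^ j)) x * w x \<le> w x * cutoff (2 ^ j) x ^ k"
      using cutoff_eq_1[of "2 ^ j" x] cut_nonneg by (auto simp: indicator_def)
  qed (use cut_nonneg in auto)
  have J_le_I: "J R \<le> I R" if "R > 0" for R
    unfolding J_def I_def
    by (rule integral_mono'[OF int_cut[OF that]]) (use cut_nonneg in \<open>auto simp: indicator_def\<close>)
  have J_le_a: "J (2 ^ j) \<le> a (Suc j) - a j" for j
  proof -
    have "J (2 ^ j) \<le> (\<integral>x. indicator (cball 0 (2 ^ Suc j)) x * w x - indicator (cball 0 (2 ^ j)) x * w x \<partial>lborel)"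
      unfolding J_def
    proof (rule integral_mono'[OF Bochner_Integration.integrable_diff[OF int_ball int_ball]])
      fix x :: 'a
      have "w x * cutoff (2 ^ j) x ^ k \<le> w x * 1"
        by (intro mult_left_mono nonneg power_le_one cutoff_nonneg cutoff_le_1)
      moreover have "norm x \<le> 2 ^ Suc j" if "norm x \<le> 2 ^ j"
        using that zero_le_power[of "2::real" j] unfolding power_Suc by linarith
      moreover have "w x * cutoff (2 ^ j) x ^ k = 0" if "x \<notin> cball 0 (2 ^ Suc j)"
        using that k cutoff_eq_0_outside[of "2 ^ j" x] by (simp add: zero_power)
      ultimately show "indicator (- cball 0 (2 ^ j)) x * (w x * cutoff (2 ^ j) x ^ k)
          \<le> indicator (cball 0 (2 ^ Suc j)) x * w x - indicator (cball 0 (2 ^ j)) x * w x"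
        using k by (auto simp: indicator_def zero_power)
      show "0 \<le> indicator (cball 0 (2 ^ Suc j)) x * w x - indicator (cball 0 (2 ^ j)) x * w x"
        using nonneg[of x] \<open>norm x \<le> 2 ^ j \<Longrightarrow> norm x \<le> 2 ^ Suc j\<close> by (auto simp: indicator_def)
    qed
    also have "\<dots> = a (Suc j) - a j"
      unfolding a_def by (rule Bochner_Integration.integral_diff[OF int_ball int_ball])
    finally show ?thesis .
  qed
  have incseq: "incseq a"
    unfolding a_def
  proof (intro incseq_SucI integral_mono int_ball)
    fix j and x :: 'a
    have "cball 0 (2 ^ j) \<subseteq> (cball 0 (2 ^ Suc j) :: 'a set)"
      by (intro subset_cball) simp
    then show "indicator (cball 0 (2 ^ j)) x * w x \<le> indicator (cball 0 (2 ^ Suc j)) x * w x"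
      using nonneg[of x] by (auto simp: indicator_def simp del: mem_cball_0 mem_cball power_Suc)
  qed
  have "\<exists>B. \<forall>j. a j \<le> B"
  proof -
    define C where "C = 1 / (2 * (M + 1))"
    have "C > 0" "M * C \<le> 1 / 2" using M by (auto simp: C_def field_simps)
    have "\<forall>\<^sub>F t in at_top. t powr (-\<gamma>) < C" "\<forall>\<^sub>F t in at_top. t powr (-\<gamma>') < C"
      using \<gamma> \<open>C > 0\<close>
      by (auto intro!: order_tendstoD(2)[OF tendsto_neg_powr] filterlim_ident)
    then have "\<forall>\<^sub>F t::real in at_top. 0 < t \<and> t powr (-\<gamma>) \<le> C \<and> t powr (-\<gamma>') \<le> C"
      using eventually_gt_at_top[of "0::real"] by eventually_elim auto
    then obtain t :: real where t: "0 < t" "t powr (-\<gamma>) \<le> C" "t powr (-\<gamma>') \<le> C"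
      using eventually_happens[of _ "at_top :: real filter"] by auto
    have "a j \<le> 2 * M * t" for j
    proof -
      have I0: "0 \<le> I (2 ^ j)" unfolding I_def by (intro integral_nonneg_AE AE_I2 cut_nonneg)
      have "I (2 ^ j) \<le> M * t + M * C * J (2 ^ j)"
        unfolding I_def J_def by (rule absorb[OF t]) simp
      also have "\<dots> \<le> M * t + M * C * I (2 ^ j)"
        using J_le_I[of "2 ^ j"] M \<open>C > 0\<close> by (intro add_left_mono mult_left_mono) auto
      also have "\<dots> \<le> M * t + 1 / 2 * I (2 ^ j)"
        using \<open>M * C \<le> 1 / 2\<close> I0 by (intro add_left_mono mult_right_mono)
      finally show ?thesis using a_le_I[of j] by simp
    qed
    then show ?thesis by blast
  qed
  then obtain L where L: "a \<longlonglongrightarrow> L" and a_le_L: "\<And>j. a j \<le> L"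
    using incseq_convergent[OF incseq] by metis
  have "L \<le> M * t" if "t > 0" for t
  proof -
    define C where "C = max (t powr (-\<gamma>)) (t powr (-\<gamma>'))"
    have "C \<ge> 0" by (simp add: C_def le_max_iff_disj)
    have "a j \<le> M * t + M * C * (a (Suc j) - a j)" for j
    proof -
      have "I (2 ^ j) \<le> M * t + M * C * J (2 ^ j)"
        unfolding I_def J_def by (rule absorb[OF that]) (auto simp: C_def)
      also have "\<dots> \<le> M * t + M * C * (a (Suc j) - a j)"
        using J_le_a M \<open>C \<ge> 0\<close> by (intro add_left_mono mult_left_mono) auto
      finally show ?thesis using a_le_I[of j] by simp
    qed
    moreover have "(\<lambda>j. M * t + M * C * (a (Suc j) - a j)) \<longlonglongrightarrow> M * t + M * C * (L - L)"
      by (intro tendsto_intros L LIMSEQ_Suc)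
    ultimately show ?thesis
      using LIMSEQ_le[OF L] by auto
  qed
  then have "\<forall>\<^sub>F t in at_right 0. L \<le> M * t"
    by (auto simp: eventually_at_filter)
  moreover have "((\<lambda>t. M * t) \<longlongrightarrow> M * 0) (at_right 0)"
    by (intro tendsto_intros)
  ultimately have "L \<le> M * 0"
    by (intro tendsto_lowerbound) auto
  then show ?thesis using a_le_L[of j] unfolding a_def by simp
qed

theorem theorem1p8:
  fixes u :: "real ^ 'n \<Rightarrow> real"
    and p q s m :: real
  assumes "CARD('n) \<ge> 2"
    and "1 < q" and "q < p" and "q < real CARD('n)"
    and "s \<ge> 0" and "m > p - 1"
    and "s * (real CARD('n) - q) + m * (real CARD('n) - 1) \<le> real CARD('n) * (q - 1)"
    and "positive_solution p q s m u"
  shows "u constant_on UNIV"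
proof -
  \<comment> \<open>Each bound on \<open>\<alpha>\<close> keeps some Young exponent positive, except \<open>\<alpha> < s\<close>, which makes the
    growth of the weighted energy governed by \<open>q\<close>.  For \<open>s = 0\<close> that growth drops out of
    the scaling condition.\<close>
  define \<beta> where "\<beta> = min (min (q - 1) (m / p)) (if s = 0 then 1 else s)"
  define \<alpha> where "\<alpha> = \<beta> / 2"
  have "0 < m" using assms by linarith
  then have "0 < \<beta>" using assms by (simp add: \<beta>_def)
  then have "0 < \<alpha>" "\<alpha> < \<beta>" by (simp_all add: \<alpha>_def)
  then have \<alpha>: "0 < \<alpha>" "\<alpha> < q - 1" "\<alpha> < m / p" "s = 0 \<or> \<alpha> < s"
    by (auto simp: \<beta>_def split: if_splits)
  then have "p * \<alpha> < m" using assms by (simp add: field_simps)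
  let ?w = "\<lambda>x. u x powr s * norm (grad u x) powr m"
  have u: "C1 u" and u_pos: "0 < u x" for x
    using assms by (auto simp: positive_solution_def)
  note growth = weighted_energy_growth[OF assms(8,2,3,6,5) \<alpha>(1,2) \<open>p * \<alpha> < m\<close>]
  have N: "real DIM(real ^ 'n) = real CARD('n)" by simp
  have "\<forall>\<^sub>F k in sequentially. \<exists>M\<ge>0. \<exists>\<gamma>>0. \<exists>\<gamma>'>0. \<forall>t>0. \<forall>C.
    t powr (-\<gamma>) \<le> C \<longrightarrow> t powr (-\<gamma>') \<le> C \<longrightarrow>
    (\<forall>R\<ge>1. (\<integral>x. ?w x * cutoff R x ^ k \<partial>lborel)
      \<le> M * t + M * C * (\<integral>x. indicator (- cball 0 R) x * (?w x * cutoff R x ^ k) \<partial>lborel))"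
  proof (rule absorption_estimate[OF assms(8,2,3,6,5) \<alpha>(1) growth], unfold N)
    fix r assume "r \<in> {p, q}"
    then show "(real CARD('n) - min ((p * s + m + (m - p) * \<alpha>) / (s + m - p + 1))
           ((q * s + m + (m - q) * \<alpha>) / (s + m - q + 1))) * ((r - 1) * s)
        + real CARD('n) * (r * s + m * (1 + \<alpha>) - (r - 1) * (1 + \<alpha> + s))
        \<le> r * s + m * (1 + \<alpha>)"
      using assms \<alpha> by (intro scaling_at_critical_exponents) auto
  qed
  from eventually_happens'[OF sequentially_bot eventually_conj[OF eventually_gt_at_top[of 0] this]]
  obtain k M \<gamma> \<gamma>' where k: "0 < k" and M: "0 \<le> M" "0 < \<gamma>" "0 < \<gamma>'"
    and absorb': "\<forall>t>0. \<forall>C. t powr (-\<gamma>) \<le> C \<longrightarrow> t powr (-\<gamma>') \<le> C \<longrightarrow>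
      (\<forall>R\<ge>1. (\<integral>x. ?w x * cutoff R x ^ k \<partial>lborel)
        \<le> M * t + M * C * (\<integral>x. indicator (- cball 0 R) x * (?w x * cutoff R x ^ k) \<partial>lborel))"
    by blast
  note absorb = absorb'[rule_format]
  have cont: "continuous_on UNIV ?w"
    using \<open>0 < m\<close> by (intro continuous_intros continuous_on_positive_powr
        continuous_on_norm_grad_powr u u_pos) auto
  have w_0: "?w x = 0" for x
    by (intro continuous_nonneg_eq_0[OF cont] absorption_imp_integral_nonpos[OF cont _ k M absorb]) auto
  then have grad_0: "grad u x = 0" for x
    using w_0[of x] u_pos[of x] by simp
  have "(u has_derivative (\<lambda>h. 0)) (at x)" for x
    using u GDERIV_grad[of u x] by (simp add: C1_def gderiv_def grad_0)
  then have "u x = u y" for x y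
    by (intro has_derivative_zero_unique[of UNIV u]) auto
  then show ?thesis
    unfolding constant_on_def by blast
qed

end
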